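(* Let $\Delta_1,\Delta_2,\ldots$ be an IID sequence of real random variables, distributed as $\Delta$ with cdf $F_\Delta$, with mean zero and finite variance $\sigma^2$. For unlimited storage capacity ($S_{\max}=\infty$), if $F_\Delta$ and $G_{\max}$ satisfy $$\limsup_{x\to\infty}xF_\Delta(-x)\le c\quad\text{for some constant }c\ge0,$$ $$\mathbb{E}\left[\alpha(G_{\max}+\Delta)^+-(G_{\max}+\Delta)^-\right]>0,$$ then $J_L(\pi^{(2)},S_1)=0$, where $\pi^{(2)}$ is the policy described in the context and $$J_L(\pi,S_1)=\limsup_{n\to\infty}\mathbb{E}\Big[\frac1n\sum_{i=1}^n1_{\{\Delta_i<-G_{\max}-\alpha_dS_i\}}\Big].$$
   Context: Constants: charging efficiency $\alpha_c\in(0,1)$, discharging efficiency $\alpha_d\in(0,1)$, round-trip efficiency $\alpha=\alpha_c\alpha_d$, fast-ramping generation capacity $G_{\max}\in[0,\infty)$. Notation: $x^+=\max\{x,0\}$, $x^-=\max\{-x,0\}$. The stored power evolves as $S_{i+1}=S_i+\alpha_cC_i-\frac1{\alpha_d}D_i$ with given $S_1\in[0,\infty)$, where $G_i,C_i,D_i$ are the fast-ramping generation, charging and discharging powers in slot $i$. The policy $\pi^{(2)}$ (the policy minimizing the average loss of load probability) for $S_{\max}=\infty$: - if $\Delta_i\ge-G_{\max}$: $(G_i,C_i,D_i)=(G_{\max},G_{\max}+\Delta_i,0)$, so $S_{i+1}=S_i+\alpha_c(G_{\max}+\Delta_i)$; - if $-G_{\max}-\alpha_dS_i\le\Delta_i<-G_{\max}$: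 $(G_{\max},0,-\Delta_i-G_{\max})$, so $S_{i+1}=S_i+(G_{\max}+\Delta_i)/\alpha_d$; - if $\Delta_i<-G_{\max}-\alpha_dS_i$: $(G_{\max},0,\alpha_dS_i)$, so $S_{i+1}=0$. *)

theory Defs
  imports "HOL-Probability.Probability"
begin

text \<open>
  A policy maps the net power \<open>\<Delta>\<^sub>i\<close> and the stored power \<open>S\<^sub>i\<close> of the current slot to the triple
  \<open>(G\<^sub>i, C\<^sub>i, D\<^sub>i)\<close> of fast-ramping generation, charging and discharging powers.
\<close>

type_synonym policy = "real \<Rightarrow> real \<Rightarrow> real \<times> real \<times> real"

text \<open>
  Storage capacity is unlimited, so the charging branch is not truncated.
\<close>

definition lolp_policy :: "real \<Rightarrow> real \<Rightarrow> policy" where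
  "lolp_policy Gmax \<alpha>d \<Delta> S =
     (if \<Delta> \<ge> - Gmax then (Gmax, Gmax + \<Delta>, 0)
      else if - Gmax - \<alpha>d * S \<le> \<Delta> then (Gmax, 0, - \<Delta> - Gmax)
      else (Gmax, 0, \<alpha>d * S))"

text \<open>
  Slots are numbered from 1. The value at index 0 is a dummy, and \<open>\<delta> 0\<close> is never used.
\<close>

fun stored_power :: "real \<Rightarrow> real \<Rightarrow> policy \<Rightarrow> real \<Rightarrow> (nat \<Rightarrow> real) \<Rightarrow> nat \<Rightarrow> real" where
  "stored_power \<alpha>c \<alpha>d \<pi> S1 \<delta> 0 = S1"
| "stored_power \<alpha>c \<alpha>d \<pi> S1 \<delta> (Suc 0) = S1"
| "stored_power \<alpha>c \<alpha>d \<pi> S1 \<delta> (Suc (Suc k)) =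
     (let S = stored_power \<alpha>c \<alpha>d \<pi> S1 \<delta> (Suc k); (G, C, D) = \<pi> (\<delta> (Suc k)) S
      in S + \<alpha>c * C - (1 / \<alpha>d) * D)"

lemma stored_power_lolp_policy:
  fixes \<alpha>c \<alpha>d Gmax S1 :: real and \<delta> :: "nat \<Rightarrow> real" and i :: nat
  assumes "\<alpha>d \<noteq> 0" and "i \<ge> 1"
  defines "S \<equiv> stored_power \<alpha>c \<alpha>d (lolp_policy Gmax \<alpha>d) S1 \<delta>"
  shows "S (Suc i) =
    (if \<delta> i \<ge> - Gmax then S i + \<alpha>c * (Gmax + \<delta> i)
     else if - Gmax - \<alpha>d * S i \<le> \<delta> i then S i + (Gmax + \<delta> i) / \<alpha>d
     else 0)"
proof -
  obtain k where "i = Suc k"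
    using \<open>i \<ge> 1\<close> by (cases i) auto
  then show ?thesis
    using \<open>\<alpha>d \<noteq> 0\<close> by (simp add: S_def lolp_policy_def Let_def field_simps)
qed

text \<open>
  The upper limit is taken in the extended reals, where it always exists.
\<close>

definition avg_lolp ::
  "'a measure \<Rightarrow> real \<Rightarrow> real \<Rightarrow> real \<Rightarrow> (nat \<Rightarrow> 'a \<Rightarrow> real) \<Rightarrow> policy \<Rightarrow> real \<Rightarrow> ereal" where
  "avg_lolp M \<alpha>c \<alpha>d Gmax \<Delta> \<pi> S1 =
     limsup (\<lambda>n. ereal (\<integral>\<omega>. (1 / real n) *
       (\<Sum>i=1..n. of_bool (\<Delta> i \<omega> < - Gmax - \<alpha>d * stored_power \<alpha>c \<alpha>d \<pi> S1 (\<lambda>j. \<Delta> j \<omega>) i)) \<partial>M))"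

end

theory Submission
  imports Defs "HOL-Real_Asymp.Real_Asymp"
begin

text \<open>
  Rescaled by \<open>\<alpha>\<^sub>d\<close>, the storage level is a random walk with IID square-integrable steps of
  positive mean, reflected at 0. It therefore dominates the free walk started at
  \<open>\<alpha>\<^sub>d S\<^sub>1\<close>, and a loss of load in slot \<open>i\<close> forces the free walk to be negative after
  \<open>i\<close> steps. By Chebyshev's inequality this has probability \<open>O(1/i)\<close>, so the average over the
  first \<open>n\<close> slots is \<open>O(log n / n)\<close>.
\<close>

text \<open>Induction on \<open>I\<close>: the new variable is independent of the sum of the others,
  so the mixed term of the square factorizes under expectation. Square integrability is carried
  through the same induction because \<open>variance_eq\<close> needs it for the partial
  sum.\<close>

lemma (in prob_space) variance_sum_indep:
  fixes X :: "'i \<Rightarrow> 'a \<Rightarrow> real"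
  assumes "finite I" "indep_vars (\<lambda>_. borel) X I"
    and "\<And>i. i \<in> I \<Longrightarrow> integrable M (X i)"
    and "\<And>i. i \<in> I \<Longrightarrow> integrable M (\<lambda>\<omega>. (X i \<omega>)\<^sup>2)"
  shows "integrable M (\<lambda>\<omega>. (\<Sum>i\<in>I. X i \<omega>)\<^sup>2)" (is ?A)
    and "variance (\<lambda>\<omega>. \<Sum>i\<in>I. X i \<omega>) = (\<Sum>i\<in>I. variance (X i))" (is ?B)
proof -
  have "?A \<and> ?B"
    using assms
  proof (induction I rule: finite_induct)
    case empty
    then show ?case by simp
  next
    case (insert i I)
    let ?T = "\<lambda>\<omega>. \<Sum>i\<in>I. X i \<omega>"
    have "indep_vars (\<lambda>_. borel) X I"
      using insert.prems(1) by (rule indep_vars_subset) auto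
    then have IH: "integrable M (\<lambda>\<omega>. (?T \<omega>)\<^sup>2)" "variance ?T = (\<Sum>i\<in>I. variance (X i))"
      using insert.IH insert.prems by auto
    have ind: "indep_var borel (X i) borel ?T"
      using insert.hyps insert.prems(1) by (rule indep_vars_sum)
    have Xi: "integrable M (X i)" "integrable M (\<lambda>\<omega>. (X i \<omega>)\<^sup>2)" and T: "integrable M ?T"
      using insert.prems by auto
    \<comment> \<open>Independence makes the product of the two integrable variables
      integrable.\<close>
    note XT = indep_var_integrable[OF ind Xi(1) T]
    have sq: "(\<lambda>\<omega>. (X i \<omega> + ?T \<omega>)\<^sup>2) = (\<lambda>\<omega>. (X i \<omega>)\<^sup>2 + (?T \<omega>)\<^sup>2 + 2 * (X i \<omega> * ?T \<omega>))"
      by (simp add: power2_sum algebra_simps)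
    have int: "integrable M (\<lambda>\<omega>. (X i \<omega> + ?T \<omega>)\<^sup>2)"
      unfolding sq using Xi IH(1) XT by auto
    \<comment> \<open>The simp rule \<open>integral_sum\<close> is removed so that
      \<open>expectation ?T\<close> stays whole and matches the variance formulas below.\<close>
    have "expectation (\<lambda>\<omega>. (X i \<omega> + ?T \<omega>)\<^sup>2)
        = expectation (\<lambda>\<omega>. (X i \<omega>)\<^sup>2) + expectation (\<lambda>\<omega>. (?T \<omega>)\<^sup>2)
          + 2 * (expectation (X i) * expectation ?T)"
      unfolding sq
      using Xi IH(1) XT
      by (simp add: indep_var_lebesgue_integral[OF ind Xi(1) T] del: Bochner_Integration.integral_sum)
    moreover have "variance (\<lambda>\<omega>. X i \<omega> + ?T \<omega>)
        = expectation (\<lambda>\<omega>. (X i \<omega> + ?T \<omega>)\<^sup>2) - (expectation (X i) + expectation ?T)\<^sup>2"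
      using Xi T int by (subst variance_eq) (auto simp del: Bochner_Integration.integral_sum)
    moreover have "variance (X i) = expectation (\<lambda>\<omega>. (X i \<omega>)\<^sup>2) - (expectation (X i))\<^sup>2"
      by (rule variance_eq[OF Xi])
    moreover have "variance ?T = expectation (\<lambda>\<omega>. (?T \<omega>)\<^sup>2) - (expectation ?T)\<^sup>2"
      by (rule variance_eq[OF T IH(1)])
    ultimately have "variance (\<lambda>\<omega>. X i \<omega> + ?T \<omega>) = variance (X i) + variance ?T"
      by (simp add: power2_sum)
    with int IH(2) insert.hyps show ?case by simp
  qed
  then show ?A ?B by auto
qed

text \<open>A nonpositive sum lies at least \<open>n * \<mu>\<close> below its mean, while its
  variance is only \<open>n * v\<close>; Chebyshev's inequality gives
  \<open>n * v / (n * \<mu>)\<^sup>2\<close>.\<close>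

lemma (in prob_space) prob_sum_indep_nonpos_le:
  fixes Y :: "nat \<Rightarrow> 'a \<Rightarrow> real"
  assumes "n \<ge> 1" "indep_vars (\<lambda>_. borel) Y {1..n}"
    and "\<And>i. i \<in> {1..n} \<Longrightarrow> integrable M (Y i)"
    and "\<And>i. i \<in> {1..n} \<Longrightarrow> integrable M (\<lambda>\<omega>. (Y i \<omega>)\<^sup>2)"
    and "\<And>i. i \<in> {1..n} \<Longrightarrow> expectation (Y i) = \<mu>" "\<mu> > 0"
    and "\<And>i. i \<in> {1..n} \<Longrightarrow> variance (Y i) = v"
  shows "prob {\<omega> \<in> space M. (\<Sum>i=1..n. Y i \<omega>) \<le> 0} \<le> v / \<mu>\<^sup>2 / real n"
proof -
  let ?T = "\<lambda>\<omega>. \<Sum>i=1..n. Y i \<omega>"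
  have [measurable]: "Y i \<in> borel_measurable M" if "i \<in> {1..n}" for i
    using assms(3)[OF that] by auto
  have [measurable]: "?T \<in> borel_measurable M"
    by measurable
  have E: "expectation ?T = real n * \<mu>"
    using assms(3,5) by simp
  have "variance ?T = (\<Sum>i=1..n. variance (Y i))"
    using assms by (intro variance_sum_indep) auto
  also have "\<dots> = real n * v"
    using assms(7) by simp
  finally have V: "variance ?T = real n * v" .
  have "prob {\<omega> \<in> space M. ?T \<omega> \<le> 0} \<le> prob {\<omega> \<in> space M. \<bar>?T \<omega> - expectation ?T\<bar> \<ge> real n * \<mu>}"
    using \<open>\<mu> > 0\<close> unfolding E by (intro finite_measure_mono) auto
  also have "\<dots> \<le> variance ?T / (real n * \<mu>)\<^sup>2"
    using assms by (intro Chebyshev_inequality variance_sum_indep) auto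
  also have "\<dots> = v / \<mu>\<^sup>2 / real n"
    unfolding V using \<open>n \<ge> 1\<close> by (simp add: power2_eq_square field_simps)
  finally show ?thesis .
qed

text \<open>With \<alpha> = \<open>\<alpha>c * \<alpha>d\<close>, this is the change of
  \<open>\<alpha>d * S\<close> in a slot without loss of load: charging contributes the factor
  \<open>\<alpha>c * \<alpha>d\<close>, and in discharging \<open>\<alpha>d\<close> cancels against
  \<open>1 / \<alpha>d\<close>.\<close>

definition drift :: "real \<Rightarrow> real \<Rightarrow> real \<Rightarrow> real" where
  "drift \<alpha> G x = \<alpha> * max (G + x) 0 - max (- (G + x)) 0"

lemma drift_measurable [measurable]: "drift \<alpha> G \<in> borel_measurable borel"
  unfolding drift_def[abs_def] by measurable

lemma integrable_drift:
  assumes "prob_space M" "X \<in> borel_measurable M" "integrable M X" "integrable M (\<lambda>\<omega>. (X \<omega>)\<^sup>2)"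
  shows "integrable M (\<lambda>\<omega>. drift \<alpha> G (X \<omega>))" "integrable M (\<lambda>\<omega>. (drift \<alpha> G (X \<omega>))\<^sup>2)"
proof -
  interpret prob_space M by fact
  note [measurable] = assms(2)
  show "integrable M (\<lambda>\<omega>. drift \<alpha> G (X \<omega>))"
    unfolding drift_def using assms by (auto intro!: integrable_max)
  have "integrable M (\<lambda>\<omega>. (\<alpha>\<^sup>2 + 1) * (G\<^sup>2 + 2 * G * X \<omega> + (X \<omega>)\<^sup>2))"
    using assms by auto
  then show "integrable M (\<lambda>\<omega>. (drift \<alpha> G (X \<omega>))\<^sup>2)"
  proof (rule Bochner_Integration.integrable_bound)
    \<comment> \<open>On either side of \<open>-G\<close> the drift is \<open>G + x\<close> times
      \<alpha> or 1; the constant \<open>\<alpha>\<^sup>2 + 1\<close> covers both squared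
      factors.\<close>
    have "(drift \<alpha> G x)\<^sup>2 \<le> (\<alpha>\<^sup>2 + 1) * (G + x)\<^sup>2" for x
    proof (cases "G + x \<ge> 0")
      case True
      then have "drift \<alpha> G x = \<alpha> * (G + x)"
        by (simp add: drift_def)
      then show ?thesis
        by (simp add: power_mult_distrib distrib_right)
    next
      case False
      then have "drift \<alpha> G x = G + x"
        by (simp add: drift_def)
      then show ?thesis
        by (simp add: distrib_right)
    qed
    moreover have "(G + x)\<^sup>2 = G\<^sup>2 + 2 * G * x + x\<^sup>2" for x
      by (simp add: power2_sum)
    ultimately have "norm ((drift \<alpha> G x)\<^sup>2) \<le> norm ((\<alpha>\<^sup>2 + 1) * (G\<^sup>2 + 2 * G * x + x\<^sup>2))" for x
      by (metis abs_ge_self norm_power order_trans power2_abs real_norm_def)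
    then show "AE \<omega> in M. norm ((drift \<alpha> G (X \<omega>))\<^sup>2)
        \<le> norm ((\<alpha>\<^sup>2 + 1) * (G\<^sup>2 + 2 * G * X \<omega> + (X \<omega>)\<^sup>2))" by simp
  qed measurable
qed

text \<open>Without loss of load, \<open>\<alpha>d * S\<close> moves exactly by the drift. In a loss
  slot the free step would lead below 0, whereas the storage stops at 0. Nonnegativity joins the
  induction since the charging branch inherits it from the preceding level. The level in slot
  \<open>Suc k\<close> depends on the first \<open>k\<close> net powers only.\<close>

lemma stored_power_lower_bound:
  fixes \<alpha>c \<alpha>d Gmax S1 :: real and \<delta> :: "nat \<Rightarrow> real"
  assumes "0 < \<alpha>c" "0 < \<alpha>d" "0 \<le> S1"
  defines "S \<equiv> stored_power \<alpha>c \<alpha>d (lolp_policy Gmax \<alpha>d) S1 \<delta>"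
  shows "S (Suc k) \<ge> 0 \<and>
    \<alpha>d * S (Suc k) \<ge> \<alpha>d * S1 + (\<Sum>j=1..k. drift (\<alpha>c * \<alpha>d) Gmax (\<delta> j))"
proof (induction k)
  case 0
  then show ?case using assms by simp
next
  case (Suc k)
  have rec: "S (Suc (Suc k)) =
    (if \<delta> (Suc k) \<ge> - Gmax then S (Suc k) + \<alpha>c * (Gmax + \<delta> (Suc k))
     else if - Gmax - \<alpha>d * S (Suc k) \<le> \<delta> (Suc k) then S (Suc k) + (Gmax + \<delta> (Suc k)) / \<alpha>d
     else 0)"
    unfolding S_def using assms by (intro stored_power_lolp_policy) auto
  have step: "S (Suc (Suc k)) \<ge> 0 \<and>
    \<alpha>d * S (Suc (Suc k)) \<ge> \<alpha>d * S (Suc k) + drift (\<alpha>c * \<alpha>d) Gmax (\<delta> (Suc k))"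
  proof (cases "\<delta> (Suc k) \<ge> - Gmax")
    case True
    then have "0 \<le> \<alpha>c * (Gmax + \<delta> (Suc k))"
      using \<open>0 < \<alpha>c\<close> by simp
    then show ?thesis
      unfolding rec using True Suc.IH by (simp add: drift_def algebra_simps)
  next
    case False
    then show ?thesis
      unfolding rec using Suc.IH \<open>0 < \<alpha>d\<close> by (auto simp: drift_def field_simps)
  qed
  have "(\<Sum>j=1..Suc k. drift (\<alpha>c * \<alpha>d) Gmax (\<delta> j))
    = (\<Sum>j=1..k. drift (\<alpha>c * \<alpha>d) Gmax (\<delta> j)) + drift (\<alpha>c * \<alpha>d) Gmax (\<delta> (Suc k))"
    by simp
  then show ?case using step Suc.IH by linarith
qed

text \<open>The drift of the losing slot itself is included: it is \<open>Gmax + \<delta> i\<close>,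
  smaller than \<open>-\<alpha>d * S i\<close>, and so outweighs the bound
  \<open>\<alpha>d * S i - \<alpha>d * S1\<close> on the sum before slot \<open>i\<close>.\<close>

lemma loss_imp_sum_drift_nonpos:
  assumes "0 < \<alpha>c" "0 < \<alpha>d" "0 \<le> S1" "i \<ge> 1"
    and loss: "\<delta> i < - Gmax - \<alpha>d * stored_power \<alpha>c \<alpha>d (lolp_policy Gmax \<alpha>d) S1 \<delta> i"
  shows "(\<Sum>j=1..i. drift (\<alpha>c * \<alpha>d) Gmax (\<delta> j)) \<le> 0"
proof -
  obtain k where i: "i = Suc k"
    using \<open>i \<ge> 1\<close> by (cases i) auto
  let ?S = "stored_power \<alpha>c \<alpha>d (lolp_policy Gmax \<alpha>d) S1 \<delta> i"
  have S: "?S \<ge> 0" "\<alpha>d * ?S \<ge> \<alpha>d * S1 + (\<Sum>j=1..k. drift (\<alpha>c * \<alpha>d) Gmax (\<delta> j))"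
    using stored_power_lower_bound[OF assms(1-3), of Gmax \<delta> k] unfolding i by auto
  have nn: "\<alpha>d * S1 \<ge> 0" "\<alpha>d * ?S \<ge> 0"
    using S(1) assms by auto
  then have "drift (\<alpha>c * \<alpha>d) Gmax (\<delta> i) = Gmax + \<delta> i"
    using loss by (simp add: drift_def)
  then have "(\<Sum>j=1..i. drift (\<alpha>c * \<alpha>d) Gmax (\<delta> j))
    = (\<Sum>j=1..k. drift (\<alpha>c * \<alpha>d) Gmax (\<delta> j)) + (Gmax + \<delta> i)"
    by (simp add: i)
  then show ?thesis using S(2) nn loss by linarith
qed

theorem proposition4:
  fixes M :: "'a measure"
    and \<Delta> :: "nat \<Rightarrow> 'a \<Rightarrow> real"
    and X :: "'a \<Rightarrow> real"
    and \<alpha>c \<alpha>d \<alpha> Gmax S1 \<sigma> c :: real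
  assumes "0 < \<alpha>c" and "\<alpha>c < 1"
    and "0 < \<alpha>d" and "\<alpha>d < 1"
    and "\<alpha> = \<alpha>c * \<alpha>d"
    and "0 \<le> Gmax"
    and "0 \<le> S1"
    and "prob_space M"
    and "prob_space.indep_vars M (\<lambda>_. borel) \<Delta> {1..}"
    and "\<And>i. i \<ge> 1 \<Longrightarrow> distr M borel (\<Delta> i) = distr M borel X"
    and "X \<in> borel_measurable M"
    and "integrable M X"
    and "(\<integral>\<omega>. X \<omega> \<partial>M) = 0"
    and "integrable M (\<lambda>\<omega>. (X \<omega>)\<^sup>2)"
    and "prob_space.variance M X = \<sigma>\<^sup>2"
    and "0 \<le> c"
    and "Limsup at_top (\<lambda>x::real. ereal (x * cdf (distr M borel X) (- x))) \<le> ereal c"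
    and "(\<integral>\<omega>. \<alpha> * max (Gmax + X \<omega>) 0 - max (- (Gmax + X \<omega>)) 0 \<partial>M) > 0"
  shows "avg_lolp M \<alpha>c \<alpha>d Gmax \<Delta> (lolp_policy Gmax \<alpha>d) S1 = 0"
proof -
  interpret prob_space M by fact
  let ?h = "drift \<alpha> Gmax"
  let ?S = "\<lambda>\<omega>. stored_power \<alpha>c \<alpha>d (lolp_policy Gmax \<alpha>d) S1 (\<lambda>j. \<Delta> j \<omega>)"
  let ?L = "\<lambda>i \<omega>. of_bool (\<Delta> i \<omega> < - Gmax - \<alpha>d * ?S \<omega> i) :: real"
  define \<mu> where "\<mu> = expectation (\<lambda>\<omega>. ?h (X \<omega>))"
  define v where "v = variance (\<lambda>\<omega>. ?h (X \<omega>))"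
  \<comment> \<open>These events involve partial sums of IID variables only, not the storage
    recursion.\<close>
  define B where "B i = {\<omega> \<in> space M. (\<Sum>j=1..i. ?h (\<Delta> j \<omega>)) \<le> 0}" for i
  have "\<mu> > 0"
    using assms(18) unfolding \<mu>_def drift_def .
  note hX = integrable_drift[OF assms(8,11,12,14), of \<alpha> Gmax]
  note [measurable] = assms(11)
  have \<Delta>_meas [measurable]: "\<Delta> i \<in> borel_measurable M" if "i \<ge> 1" for i
    using assms(9) that unfolding indep_vars_def by auto
  \<comment> \<open>Equal distributions transfer moments from \<open>X\<close> to each
    \<open>\<Delta> i\<close>; \<open>f\<close> will be \<open>?h\<close>, its square, and its
    square after centring at \<mu>.\<close>
  have expectation_\<Delta>: "expectation (\<lambda>\<omega>. f (\<Delta> i \<omega>)) = expectation (\<lambda>\<omega>. f (X \<omega>))"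
    and integrable_\<Delta>: "integrable M (\<lambda>\<omega>. f (\<Delta> i \<omega>)) \<longleftrightarrow> integrable M (\<lambda>\<omega>. f (X \<omega>))"
    if i: "i \<ge> 1" and [measurable]: "f \<in> borel_measurable borel" for i and f :: "real \<Rightarrow> real"
    using integral_distr[OF \<Delta>_meas[OF i] that(2)] integral_distr[OF assms(11) that(2)]
      integrable_distr_eq[OF \<Delta>_meas[OF i] that(2)] integrable_distr_eq[OF assms(11) that(2)]
      assms(10)[OF i] by auto
  have prob_B: "prob (B i) \<le> v / \<mu>\<^sup>2 / real i" if "i \<ge> 1" for i
    unfolding B_def
  proof (rule prob_sum_indep_nonpos_le)
    show "indep_vars (\<lambda>_. borel) (\<lambda>j \<omega>. ?h (\<Delta> j \<omega>)) {1..i}"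
      using assms(9) by (rule indep_vars_compose2[OF indep_vars_subset]) auto
    show "variance (\<lambda>\<omega>. ?h (\<Delta> j \<omega>)) = v" if "j \<in> {1..i}" for j
      using that expectation_\<Delta>[of j ?h] expectation_\<Delta>[of j "\<lambda>x. (?h x - \<mu>)\<^sup>2"]
      unfolding v_def \<mu>_def by simp
  qed (use that \<open>\<mu> > 0\<close> hX in \<open>auto simp: \<mu>_def expectation_\<Delta> integrable_\<Delta>
        integrable_\<Delta>[of _ "\<lambda>x. (?h x)\<^sup>2"]\<close>)
  have "v \<ge> 0"
    unfolding v_def by (rule variance_positive)
  have B_sets [measurable]: "B i \<in> sets M" for i
  proof -
    have "(\<lambda>\<omega>. \<Sum>j=1..i. ?h (\<Delta> j \<omega>)) \<in> borel_measurable M"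
      by (intro borel_measurable_sum measurable_compose[OF \<Delta>_meas drift_measurable]) auto
    then show ?thesis unfolding B_def by measurable
  qed
  have L_le: "?L i \<omega> \<le> indicator (B i) \<omega>" if "i \<ge> 1" "\<omega> \<in> space M" for i \<omega>
    using that loss_imp_sum_drift_nonpos[OF assms(1,3,7) that(1), of "\<lambda>j. \<Delta> j \<omega>" Gmax]
    by (auto simp: B_def assms(5) indicator_def)
  let ?a = "\<lambda>n. expectation (\<lambda>\<omega>. (1 / real n) * (\<Sum>i=1..n. ?L i \<omega>))"
  have upper: "?a n \<le> v / \<mu>\<^sup>2 * ((ln (real n) + 1) / real n)" if "n \<ge> 1" for n
  proof -
    have "?a n \<le> expectation (\<lambda>\<omega>. (1 / real n) * (\<Sum>i=1..n. indicator (B i) \<omega>))"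
    \<comment> \<open>This rule asks for integrability of the larger function only. A nonintegrable
      left side would have integral 0 by convention, which is why the larger function must be
      nonnegative.\<close>
    proof (rule integral_mono')
      show "integrable M (\<lambda>\<omega>. (1 / real n) * (\<Sum>i=1..n. indicator (B i) \<omega>))"
        by (intro integrable_mult_right Bochner_Integration.integrable_sum)
          (auto simp: emeasure_eq_measure)
      show "(1 / real n) * (\<Sum>i=1..n. ?L i \<omega>) \<le> (1 / real n) * (\<Sum>i=1..n. indicator (B i) \<omega>)"
        if "\<omega> \<in> space M" for \<omega>
        using that by (intro mult_left_mono sum_mono L_le) auto
      show "0 \<le> (1 / real n) * (\<Sum>i=1..n. indicator (B i) \<omega> :: real)" for \<omega>
        by (intro mult_nonneg_nonneg sum_nonneg) auto
    qed
    also have "\<dots> = (1 / real n) * (\<Sum>i=1..n. prob (B i))"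
      by (simp add: Bochner_Integration.integral_sum emeasure_eq_measure)
    also have "\<dots> \<le> (1 / real n) * (\<Sum>i=1..n. v / \<mu>\<^sup>2 / real i)"
      by (intro mult_left_mono sum_mono prob_B) auto
    also have "\<dots> = v / \<mu>\<^sup>2 * (harm n / real n)"
      by (simp add: harm_def sum_distrib_left sum_divide_distrib field_simps)
    also have "\<dots> \<le> v / \<mu>\<^sup>2 * ((ln (real n) + 1) / real n)"
      \<comment> \<open>The sequence \<open>harm n - ln n\<close> decreases from its value 1 at
        \<open>n = 1\<close>.\<close>
      using \<open>v \<ge> 0\<close> that euler_mascheroni_sequence_decreasing[of 1 n]
      by (intro mult_left_mono divide_right_mono) (auto simp: harm_def)
    finally show ?thesis .
  qed
  have "?a \<longlonglongrightarrow> 0"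
  proof (rule tendsto_sandwich)
    \<comment> \<open>Valid even at \<open>n = 0\<close>, where \<open>1 / real n\<close> is
      0.\<close>
    show "\<forall>\<^sub>F n in sequentially. 0 \<le> ?a n"
      by (intro always_eventually allI Bochner_Integration.integral_nonneg
          mult_nonneg_nonneg sum_nonneg) auto
    show "\<forall>\<^sub>F n in sequentially. ?a n \<le> v / \<mu>\<^sup>2 * ((ln (real n) + 1) / real n)"
      using upper by (auto simp: eventually_sequentially)
    have "(\<lambda>n. (ln (real n) + 1) / real n) \<longlonglongrightarrow> 0"
      by real_asymp
    then show "(\<lambda>n. v / \<mu>\<^sup>2 * ((ln (real n) + 1) / real n)) \<longlonglongrightarrow> 0"
      by (rule tendsto_mult_right_zero)
  qed simp
  then have "(\<lambda>n. ereal (?a n)) \<longlonglongrightarrow> 0"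
    by (simp add: zero_ereal_def)
  \<comment> \<open>The averages converge, so their upper limit is the limit.\<close>
  then show ?thesis
    unfolding avg_lolp_def by (intro lim_imp_Limsup) simp_all
qed

end
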